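(* Let $n\ge1$, and for $r=1,2$ let $\vec{\alpha_r}=(\alpha_{r1},\dots,\alpha_{rn})$ with all $\alpha_{ri}>0$ and $\vec{p_r}=(p_{r1},\dots,p_{rn})$ with all $0<p_{ri}<1$. Let $\mathcal{N}_r=\sum_{i=1}^n N_{\alpha_{ri},p_{ri}}$, a sum of independent negative binomial random variables. If $(\vec{\alpha_1},\vec{p_1})\le^a(\vec{\alpha_2},\vec{p_2})$, then $\mathcal{N}_1\ge_{conv}\mathcal{N}_2$.
   Context: For $\alpha>0$, $0<p<1$, $q=1-p$: $P(N_{\alpha,p}=k)=\binom{k+\alpha-1}{k}p^\alpha q^k$, $k=0,1,2,\dots$. $Y\ge_{conv}X$ (equivalently $X\le_{conv}Y$) means $Y$ has the same distribution as $X+Z$ for some nonnegative random variable $Z$ independent of $X$. For $\vec{x}\in\mathbb{R}^n$, $\vec{x}_\uparrow$ is the vector of components of $\vec{x}$ arranged in increasing order. $(\vec{x_1},\vec{y_1})=^a(\vec{x_2},\vec{y_2})$ means that there is one permutation $\pi$ with $\vec{x_1}=\pi(\vec{x_2})$ and $\vec{y_1}=\pi(\vec{y_2})$. The arrangement order: $(\vec{x_1},\vec{y_1})\le^a(\vec{x_2},\vec{y_2})$ if there are finitely many vectors $\vec{\phi_1},\dots,\vec{\phi_k}$ with $(\vec{x_1},\vec{y_1})=^a((\vec{x_1})_\uparrow,\vec{\phi_1})$, $((\vec{x_1})_\uparrow,\vec{\phi_k})=^a(\vec{x_2},\vec{y_2})$, and for each $s=1,\dots,k-1$ the vector $\vec{\phi}_{s+1}$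 is obtained from $\vec{\phi}_s$ by interchanging two components, at positions $i<j$, where the component at position $i$ is larger than that at position $j$. *)

theory Defs
  imports "HOL-Probability.Probability" "HOL-Combinatorics.Combinatorics"
begin

definition neg_binomial_mass :: "real \<Rightarrow> real \<Rightarrow> nat \<Rightarrow> real" where
  "neg_binomial_mass \<alpha> p k = ((real k + \<alpha> - 1) gchoose k) * p powr \<alpha> * (1 - p) ^ k"

text \<open>
  The masses sum to 1, so prescribing them on the natural numbers determines the distribution.
\<close>
lemma neg_binomial_mass_sums:
  assumes "0 < p" "p < 1"
  shows "neg_binomial_mass \<alpha> p sums 1"
proof -
  have "(\<lambda>k. ((- \<alpha>) gchoose k) * (p - 1) ^ k) sums (1 + (p - 1)) powr (- \<alpha>)"
    using assms by (intro gen_binomial_real) auto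
  then have "(\<lambda>k. p powr \<alpha> * (((- \<alpha>) gchoose k) * (p - 1) ^ k)) sums (p powr \<alpha> * p powr (- \<alpha>))"
    by (intro sums_mult) simp
  moreover have "p powr \<alpha> * p powr (- \<alpha>) = 1"
    using assms by (simp add: powr_minus)
  moreover have "p powr \<alpha> * (((- \<alpha>) gchoose k) * (p - 1) ^ k) = neg_binomial_mass \<alpha> p k" for k
  proof -
    have "(p - 1) ^ k = (- 1) ^ k * (1 - p) ^ k"
      by (simp flip: power_mult_distrib)
    moreover have "(- \<alpha>) gchoose k = (- 1) ^ k * ((real k + \<alpha> - 1) gchoose k)"
      using gbinomial_negated_upper[of "- \<alpha>" k] by (simp add: algebra_simps)
    ultimately show ?thesis
      by (simp add: neg_binomial_mass_def flip: power_mult_distrib)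
  qed
  ultimately show ?thesis by simp
qed

definition neg_binomial_rv :: "'a measure \<Rightarrow> ('a \<Rightarrow> real) \<Rightarrow> real \<Rightarrow> real \<Rightarrow> bool" where
  "neg_binomial_rv M X \<alpha> p \<longleftrightarrow>
     X \<in> borel_measurable M \<and>
     (\<forall>k::nat. measure M {\<omega> \<in> space M. X \<omega> = real k} = neg_binomial_mass \<alpha> p k)"

text \<open>
  \<open>conv_le M X N Y\<close> is \<open>X \<le>\<^sub>c\<^sub>o\<^sub>n\<^sub>v Y\<close>, for \<open>X\<close> defined on \<open>M\<close> and \<open>Y\<close> on \<open>N\<close>.  The order is a
  relation between distributions: since \<open>M\<close> need not carry a suitable \<open>Z\<close>, the independent pair
  is a copy \<open>X'\<close> of \<open>X\<close> together with \<open>Z\<close> on some probability space.  Taking the underlying type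
  to be pairs of reals loses nothing, as only the joint law of \<open>(X', Z)\<close> matters.
\<close>
definition conv_le ::
    "'a measure \<Rightarrow> ('a \<Rightarrow> real) \<Rightarrow> 'b measure \<Rightarrow> ('b \<Rightarrow> real) \<Rightarrow> bool" where
  "conv_le M X N Y \<longleftrightarrow>
     X \<in> borel_measurable M \<and> Y \<in> borel_measurable N \<and>
     (\<exists>(\<Omega> :: (real \<times> real) measure) X' Z.
        prob_space \<Omega> \<and>
        prob_space.indep_var \<Omega> borel X' borel Z \<and>
        (\<forall>\<omega>\<in>space \<Omega>. 0 \<le> Z \<omega>) \<and>
        distr \<Omega> borel X' = distr M borel X \<and>
        distr \<Omega> borel (\<lambda>\<omega>. X' \<omega> + Z \<omega>) = distr N borel Y)"

text \<open>Vectors in \<open>\<real>\<^sup>n\<close> are lists of length \<open>n\<close>; \<open>sort x\<close> is \<open>x\<^sub>\<up>\<close> (weakly increasing).\<close>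

definition arr_eq :: "real list \<times> real list \<Rightarrow> real list \<times> real list \<Rightarrow> bool" where
  "arr_eq = (\<lambda>(x1, y1) (x2, y2).
     length x2 = length y2 \<and>
     (\<exists>\<pi>. \<pi> permutes {..<length x2} \<and> x1 = permute_list \<pi> x2 \<and> y1 = permute_list \<pi> y2))"

definition inversion_swap :: "real list \<Rightarrow> real list \<Rightarrow> bool" where
  "inversion_swap \<phi> \<psi> \<longleftrightarrow>
     (\<exists>i j. i < j \<and> j < length \<phi> \<and> \<phi> ! i > \<phi> ! j \<and> \<psi> = \<phi>[i := \<phi> ! j, j := \<phi> ! i])"

definition arr_le :: "real list \<times> real list \<Rightarrow> real list \<times> real list \<Rightarrow> bool" where
  "arr_le = (\<lambda>(x1, y1) (x2, y2).
     \<exists>\<phi>s. \<phi>s \<noteq> [] \<and>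
       arr_eq (x1, y1) (sort x1, hd \<phi>s) \<and>
       arr_eq (sort x1, last \<phi>s) (x2, y2) \<and>
       (\<forall>s. Suc s < length \<phi>s \<longrightarrow> inversion_swap (\<phi>s ! s) (\<phi>s ! Suc s)))"

end

theory Submission
  imports Defs
begin

text \<open>
  Encode laws on the natural numbers by their probability generating functions, as formal power
  series, so that sums of independent variables become products.  Suppose \<open>a \<le> b\<close> and \<open>v < u\<close>.
  Writing \<open>N\<^bsub>b,p\<^esub>\<close> as \<open>N\<^bsub>a,p\<^esub> + N\<^bsub>b-a,p\<^esub>\<close>, one sees that moving from the pairing
  \<open>(a,u), (b,v)\<close> to \<open>(a,v), (b,u)\<close> only replaces a factor \<open>N\<^bsub>b-a,v\<^esub>\<close> by \<open>N\<^bsub>b-a,u\<^esub>\<close>.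
  The quotient of the corresponding generating functions is a constant times
  \<open>((1 - (1-u) z) / (1 - (1-v) z)) ^ (b-a)\<close>.  Its logarithmic derivative has the nonnegative
  coefficients \<open>(b-a) ((1-v)^(k+1) - (1-u)^(k+1))\<close>, so the quotient has nonnegative coefficients and
  is itself a probability generating function, namely that of the required summand \<open>Z\<close>.
\<close>

section \<open>Probability generating functions\<close>

definition is_pgf :: "real fps \<Rightarrow> bool" where
  "is_pgf f \<longleftrightarrow> (\<forall>k. 0 \<le> fps_nth f k) \<and> fps_nth f sums 1"

lemma is_pgf_nonneg: "is_pgf f \<Longrightarrow> 0 \<le> fps_nth f k"
  by (simp add: is_pgf_def)

lemma is_pgf_sums: "is_pgf f \<Longrightarrow> fps_nth f sums 1"
  by (simp add: is_pgf_def)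

text \<open>The coefficients of a product form the Cauchy product; nonnegativity makes both
  convergences absolute, so the sums multiply.\<close>

lemma fps_mult_sums:
  fixes f g :: "real fps"
  assumes "\<And>k. 0 \<le> fps_nth f k" "\<And>k. 0 \<le> fps_nth g k"
    and "summable (fps_nth f)" "summable (fps_nth g)"
  shows "fps_nth (f * g) sums (suminf (fps_nth f) * suminf (fps_nth g))"
proof -
  have "fps_nth (f * g) = (\<lambda>k. \<Sum>i\<le>k. fps_nth f i * fps_nth g (k - i))"
    by (auto simp: fps_mult_nth atMost_atLeast0)
  then show ?thesis
    using Cauchy_product_sums[of "fps_nth f" "fps_nth g"] assms by simp
qed

lemma fps_mult_nonneg:
  fixes f g :: "real fps"
  assumes "\<And>k. 0 \<le> fps_nth f k" "\<And>k. 0 \<le> fps_nth g k"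
  shows "0 \<le> fps_nth (f * g) k"
  by (simp add: fps_mult_nth sum_nonneg assms)

lemma is_pgf_1: "is_pgf 1"
proof -
  have "fps_nth 1 = (\<lambda>k. if k = 0 then 1 else (0::real))"
    by auto
  then show ?thesis
    using sums_single[of 0 "\<lambda>_. 1::real"] by (simp add: is_pgf_def)
qed

lemma is_pgf_mult:
  assumes "is_pgf f" "is_pgf g"
  shows "is_pgf (f * g)"
  using fps_mult_sums[of f g] fps_mult_nonneg[of f g] assms
  by (auto simp: is_pgf_def sums_iff)

text \<open>The term \<open>i = k\<close> of the convolution bounds the coefficients of
  \<open>f\<close> by a multiple of those of \<open>f * g\<close>, so \<open>f\<close> is summable;
  comparing total masses then forces its sum to be 1.\<close>

lemma is_pgf_quotient:
  assumes g: "is_pgf g" and fg: "is_pgf (f * g)"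
    and g0: "fps_nth g 0 > 0" and f: "\<And>k. 0 \<le> fps_nth f k"
  shows "is_pgf f"
proof -
  have "fps_nth f k \<le> fps_nth (f * g) k / fps_nth g 0" for k
  proof -
    have "fps_nth f k * fps_nth g (k - k) \<le> (\<Sum>i\<le>k. fps_nth f i * fps_nth g (k - i))"
      using f is_pgf_nonneg[OF g]
      by (intro member_le_sum[where f = "\<lambda>i. fps_nth f i * fps_nth g (k - i)"]) auto
    then show ?thesis
      using g0 by (simp add: fps_mult_nth atMost_atLeast0 field_simps)
  qed
  then have bound: "norm (fps_nth f k) \<le> fps_nth (f * g) k / fps_nth g 0" for k
    using f by simp
  have "summable (\<lambda>k. fps_nth (f * g) k / fps_nth g 0)"
    using is_pgf_sums[OF fg] by (intro summable_divide) (simp add: sums_iff)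
  then have summ: "summable (fps_nth f)"
    by (rule summable_comparison_test'[where N = 0]) (rule bound)
  have "fps_nth (f * g) sums (suminf (fps_nth f) * suminf (fps_nth g))"
    using g by (intro fps_mult_sums f summ) (auto simp: is_pgf_def sums_iff)
  then have "suminf (fps_nth f) = 1"
    using is_pgf_sums[OF fg] is_pgf_sums[OF g] by (simp add: sums_iff)
  with summ f show ?thesis
    by (auto simp: is_pgf_def sums_iff)
qed

text \<open>This is the convolution order for laws on the naturals: the cofactor \<open>h\<close> is
  the generating function of the added summand.\<close>

definition pgf_dvd :: "real fps \<Rightarrow> real fps \<Rightarrow> bool" where
  "pgf_dvd f g \<longleftrightarrow> (\<exists>h. is_pgf h \<and> g = h * f)"

lemma pgf_dvd_refl: "pgf_dvd f f"
  unfolding pgf_dvd_def by (rule exI[of _ 1]) (simp add: is_pgf_1)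

lemma pgf_dvd_trans: "pgf_dvd f g \<Longrightarrow> pgf_dvd g h \<Longrightarrow> pgf_dvd f h"
  unfolding pgf_dvd_def by (metis is_pgf_mult mult.assoc)

lemma pgf_dvd_mult_left: "pgf_dvd f g \<Longrightarrow> pgf_dvd (h * f) (h * g)"
  unfolding pgf_dvd_def by (metis mult.left_commute)

section \<open>Generating functions of negative binomial laws\<close>

definition nb_fps :: "real \<Rightarrow> real \<Rightarrow> real fps" where
  "nb_fps \<alpha> p = Abs_fps (neg_binomial_mass \<alpha> p)"

text \<open>Negating the upper index of the binomial coefficient absorbs the signs. This form makes
  the exponent law of the binomial series available.\<close>

lemma nb_fps_eq_binomial:
  "nb_fps \<alpha> p =
     fps_const (p powr \<alpha>) * (fps_binomial (- \<alpha>) oo (fps_const (p - 1) * fps_X))"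
proof (rule fps_ext)
  fix k
  have "(p - 1) ^ k = (- 1) ^ k * (1 - p) ^ k"
    by (simp flip: power_mult_distrib)
  moreover have "(- \<alpha>) gchoose k = (- 1) ^ k * ((real k + \<alpha> - 1) gchoose k)"
    using gbinomial_negated_upper[of "- \<alpha>" k] by (simp add: algebra_simps)
  ultimately show "fps_nth (nb_fps \<alpha> p) k = fps_nth
    (fps_const (p powr \<alpha>) * (fps_binomial (- \<alpha>) oo (fps_const (p - 1) * fps_X))) k"
    by (simp add: nb_fps_def neg_binomial_mass_def flip: power_mult_distrib)
qed

lemma nb_fps_add:
  assumes "0 < p"
  shows "nb_fps (\<alpha> + \<beta>) p = nb_fps \<alpha> p * nb_fps \<beta> p"
proof -
  have "fps_binomial (- \<alpha> - \<beta>) = fps_binomial (- \<alpha>) * fps_binomial (- \<beta>)"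
    using fps_binomial_add_mult[of "- \<alpha>" "- \<beta>"] by simp
  moreover have "fps_const ((p::real) powr (\<alpha> + \<beta>)) = fps_const (p powr \<alpha>) * fps_const (p powr \<beta>)"
    by (simp add: powr_add)
  ultimately show ?thesis
    by (simp add: nb_fps_eq_binomial fps_compose_mult_distrib ac_simps
        del: fps_const_mult)
qed

lemma nb_fps_0: "0 < p \<Longrightarrow> nb_fps 0 p = 1"
  by (simp add: nb_fps_eq_binomial)

lemma nb_fps_nth_0: "fps_nth (nb_fps \<alpha> p) 0 = p powr \<alpha>"
  by (simp add: nb_fps_def neg_binomial_mass_def)

text \<open>The absorption identity for binomial coefficients, kept free of division. It yields both
  nonnegativity by induction and the differential equation of the series.\<close>

lemma nb_fps_nth_Suc:
  "real (Suc k) * fps_nth (nb_fps \<alpha> p) (Suc k) =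
     (real k + \<alpha>) * (1 - p) * fps_nth (nb_fps \<alpha> p) k"
proof -
  have "real (Suc k) * ((real k + \<alpha>) gchoose Suc k) = (real k + \<alpha>) * ((real k + \<alpha> - 1) gchoose k)"
    by (rule gbinomial_absorption)
  moreover have "real (Suc k) + \<alpha> - 1 = real k + \<alpha>"
    by simp
  ultimately have "real (Suc k) * neg_binomial_mass \<alpha> p (Suc k) =
      ((real k + \<alpha>) * ((real k + \<alpha> - 1) gchoose k)) * (p powr \<alpha> * (1 - p) ^ Suc k)"
    unfolding neg_binomial_mass_def by (metis (no_types, lifting) mult.assoc)
  then show ?thesis
    by (simp add: nb_fps_def neg_binomial_mass_def)
qed

text \<open>A zero exponent is included because the difference of two exponents may vanish.\<close>

lemma is_pgf_nb_fps:
  assumes "0 \<le> \<alpha>" "0 < p" "p < 1"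
  shows "is_pgf (nb_fps \<alpha> p)"
proof -
  have "0 \<le> fps_nth (nb_fps \<alpha> p) k" for k
  proof (induction k)
    case 0
    show ?case by (simp add: nb_fps_nth_0)
  next
    case (Suc k)
    have "0 \<le> real (Suc k) * fps_nth (nb_fps \<alpha> p) (Suc k)"
      unfolding nb_fps_nth_Suc using Suc assms by simp
    then show ?case by (simp add: zero_le_mult_iff)
  qed
  moreover have "fps_nth (nb_fps \<alpha> p) sums 1"
    using neg_binomial_mass_sums[OF assms(2,3), of \<alpha>] by (simp add: nb_fps_def Abs_fps_inverse)
  ultimately show ?thesis by (simp add: is_pgf_def)
qed

section \<open>Logarithmic derivatives and comparison of success probabilities\<close>

lemma geometric_fps_inverse:
  fixes q :: real
  shows "(1 - fps_const q * fps_X) * Abs_fps (\<lambda>k. q ^ k) = 1"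
proof (rule fps_ext)
  fix k
  show "fps_nth ((1 - fps_const q * fps_X) * Abs_fps (\<lambda>k. q ^ k)) k = fps_nth 1 k"
    by (cases k) (simp_all add: left_diff_distrib mult.assoc)
qed

text \<open>With q = 1 - p, the logarithmic derivative of (1 - qX)^(-\<alpha>) is \<alpha> q / (1 -
  qX), and the geometric series stands for 1 / (1 - qX).\<close>

lemma nb_fps_deriv:
  "fps_deriv (nb_fps \<alpha> p) =
     fps_const (\<alpha> * (1 - p)) * Abs_fps (\<lambda>k. (1 - p) ^ k) * nb_fps \<alpha> p"
proof -
  let ?L = "1 - fps_const (1 - p) * fps_X" and ?E = "Abs_fps (\<lambda>k. (1 - p) ^ k)"
  \<comment> \<open>Cleared of its denominator, the equation is the coefficient recurrence.\<close>
  have "?L * fps_deriv (nb_fps \<alpha> p) = fps_const (\<alpha> * (1 - p)) * nb_fps \<alpha> p"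
  proof (rule fps_ext)
    fix k
    show "fps_nth (?L * fps_deriv (nb_fps \<alpha> p)) k =
        fps_nth (fps_const (\<alpha> * (1 - p)) * nb_fps \<alpha> p) k"
      using nb_fps_nth_Suc[of k \<alpha> p]
      by (cases k) (simp_all add: left_diff_distrib mult.assoc algebra_simps)
  qed
  then have "?E * (?L * fps_deriv (nb_fps \<alpha> p)) = fps_const (\<alpha> * (1 - p)) * ?E * nb_fps \<alpha> p"
    by (simp only: ac_simps)
  moreover have "?E * (?L * fps_deriv (nb_fps \<alpha> p)) = (?L * ?E) * fps_deriv (nb_fps \<alpha> p)"
    by (simp only: ac_simps)
  ultimately show ?thesis
    by (simp only: geometric_fps_inverse mult_1_left)
qed

text \<open>Comparing coefficients at \<open>m\<close> expresses \<open>Suc m\<close> times the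
  coefficient of \<open>f\<close> at \<open>Suc m\<close> as a nonnegative combination of earlier
  ones, so strong induction applies.\<close>

lemma fps_nonneg_if_log_deriv_nonneg:
  fixes f h :: "real fps"
  assumes "fps_deriv f = h * f" "\<And>k. 0 \<le> fps_nth h k" "0 \<le> fps_nth f 0"
  shows "0 \<le> fps_nth f k"
proof (induction k rule: less_induct)
  case (less k)
  show ?case
  proof (cases k)
    case 0
    then show ?thesis using assms(3) by simp
  next
    case (Suc m)
    have "real (Suc m) * fps_nth f (Suc m) = fps_nth (fps_deriv f) m"
      by simp
    also have "\<dots> = (\<Sum>i=0..m. fps_nth h i * fps_nth f (m - i))"
      by (simp add: assms(1) fps_mult_nth)
    also have "\<dots> \<ge> 0"
      using less Suc assms(2) by (intro sum_nonneg mult_nonneg_nonneg) auto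
    finally show ?thesis
      using Suc by (simp add: zero_le_mult_iff)
  qed
qed

text \<open>In terms of laws: at a fixed exponent, lowering the success probability from
  \<open>u\<close> to \<open>v\<close> adds an independent nonnegative summand.\<close>

lemma nb_fps_pgf_dvd:
  assumes "0 \<le> c" "0 < v" "v \<le> u" "u < 1"
  shows "pgf_dvd (nb_fps c u) (nb_fps c v)"
proof -
  \<comment> \<open>This is the quotient, since \<open>nb_fps (- c) u\<close> inverts
    \<open>nb_fps c u\<close>.\<close>
  define g where "g = nb_fps c v * nb_fps (- c) u"
  \<comment> \<open>Logarithmic derivatives of the two factors add; the exponent \<open>- c\<close>
    gives the second a minus sign.\<close>
  define h where "h = fps_const (c * (1 - v)) * Abs_fps (\<lambda>k. (1 - v) ^ k) +
    fps_const (- c * (1 - u)) * Abs_fps (\<lambda>k. (1 - u) ^ k)"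
  have deriv: "fps_deriv g = h * g"
    by (simp only: g_def h_def fps_deriv_mult nb_fps_deriv) (simp only: algebra_simps)
  have h_nonneg: "0 \<le> fps_nth h k" for k
  proof -
    have "fps_nth h k = c * ((1 - v) ^ Suc k - (1 - u) ^ Suc k)"
      by (simp add: h_def algebra_simps)
    moreover have "(1 - u) ^ Suc k \<le> (1 - v) ^ Suc k"
      using assms by (intro power_mono) auto
    ultimately show ?thesis using assms by simp
  qed
  have nonneg: "0 \<le> fps_nth g k" for k
    by (rule fps_nonneg_if_log_deriv_nonneg[OF deriv h_nonneg])
       (simp add: g_def nb_fps_nth_0)
  have "nb_fps (- c) u * nb_fps c u = 1"
    using nb_fps_add[of u "- c" c] nb_fps_0[of u] assms by simp
  then have eq: "g * nb_fps c u = nb_fps c v"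
    by (simp add: g_def mult.assoc)
  have "is_pgf g"
  proof (rule is_pgf_quotient)
    show "is_pgf (nb_fps c u)" "is_pgf (g * nb_fps c u)"
      using assms by (auto simp: eq intro!: is_pgf_nb_fps)
    show "fps_nth (nb_fps c u) 0 > 0"
      using assms by (simp add: nb_fps_nth_0)
  qed (rule nonneg)
  then show ?thesis
    unfolding pgf_dvd_def using eq by metis
qed

lemma nb_fps_swap_pgf_dvd:
  assumes "a \<le> b" "0 < v" "v \<le> u" "u < 1"
  shows "pgf_dvd (nb_fps a v * nb_fps b u) (nb_fps a u * nb_fps b v)"
proof -
  have "nb_fps b p = nb_fps a p * nb_fps (b - a) p" if "0 < p" for p
    using nb_fps_add[OF that, of a "b - a"] by simp
  then have *: "nb_fps a v * nb_fps b u = (nb_fps a v * nb_fps a u) * nb_fps (b - a) u"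
      "nb_fps a u * nb_fps b v = (nb_fps a v * nb_fps a u) * nb_fps (b - a) v"
    using assms by (simp_all add: ac_simps)
  show ?thesis
    unfolding * using assms by (intro pgf_dvd_mult_left nb_fps_pgf_dvd) auto
qed

section \<open>Rearranging the parameters\<close>

definition nb_sum_fps :: "real list \<Rightarrow> real list \<Rightarrow> real fps" where
  "nb_sum_fps \<alpha> p = (\<Prod>i<length \<alpha>. nb_fps (\<alpha> ! i) (p ! i))"

text \<open>One permutation acts on both vectors, so it merely reindexes the factors of a
  commutative product.\<close>

lemma arr_eq_nb_sum_fps:
  assumes "arr_eq (x1, y1) (x2, y2)"
  shows "nb_sum_fps x1 y1 = nb_sum_fps x2 y2"
proof -
  from assms obtain \<pi> where len: "length x2 = length y2"
    and \<pi>: "\<pi> permutes {..<length x2}" "x1 = permute_list \<pi> x2" "y1 = permute_list \<pi> y2"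
    by (auto simp: arr_eq_def)
  have "nb_sum_fps x1 y1 = (\<Prod>i<length x2. nb_fps (x2 ! \<pi> i) (y2 ! \<pi> i))"
    unfolding nb_sum_fps_def using \<pi> len by (intro prod.cong) (auto simp: permute_list_nth)
  also have "\<dots> = nb_sum_fps x2 y2"
    unfolding nb_sum_fps_def
    using prod.permute[OF \<pi>(1), of "\<lambda>i. nb_fps (x2 ! i) (y2 ! i)"] by (simp add: o_def)
  finally show ?thesis .
qed

lemma arr_eq_set_length:
  assumes "arr_eq (x1, y1) (x2, y2)"
  shows "set y2 = set y1" "length x2 = length y2"
  using assms by (auto simp: arr_eq_def)

lemma inversion_swap_set_length:
  "inversion_swap \<phi> \<psi> \<Longrightarrow> set \<psi> = set \<phi>" "inversion_swap \<phi> \<psi> \<Longrightarrow> length \<psi> = length \<phi>"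
  by (auto simp: inversion_swap_def)

text \<open>As \<open>x\<close> is sorted, the swap moves the larger probability to the position
  whose exponent is at least as large, and the factors elsewhere stay. Hence the direction: the
  later vector gives the divisor.\<close>

lemma inversion_swap_pgf_dvd:
  assumes swap: "inversion_swap \<phi> \<psi>" and "sorted x" "length x = length \<phi>"
    and \<phi>: "\<forall>p\<in>set \<phi>. 0 < p \<and> p < 1"
  shows "pgf_dvd (nb_sum_fps x \<psi>) (nb_sum_fps x \<phi>)"
proof -
  from swap obtain i j where ij: "i < j" "j < length \<phi>" "\<phi> ! i > \<phi> ! j"
    and \<psi>: "\<psi> = \<phi>[i := \<phi> ! j, j := \<phi> ! i]"
    by (auto simp: inversion_swap_def)
  define R where "R = {..<length x} - {i, j}"
  have split: "nb_sum_fps x \<rho> = (\<Prod>k\<in>R. nb_fps (x ! k) (\<rho> ! k)) *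
      (nb_fps (x ! i) (\<rho> ! i) * nb_fps (x ! j) (\<rho> ! j))" for \<rho>
  proof -
    have "{..<length x} = insert i (insert j R)"
      using ij assms(3) by (auto simp: R_def)
    moreover have "finite R" "i \<notin> R" "j \<notin> R" "i \<noteq> j"
      using ij by (auto simp: R_def)
    ultimately show ?thesis
      by (simp add: nb_sum_fps_def ac_simps)
  qed
  have rest: "(\<Prod>k\<in>R. nb_fps (x ! k) (\<psi> ! k)) = (\<Prod>k\<in>R. nb_fps (x ! k) (\<phi> ! k))"
    by (rule prod.cong) (auto simp: R_def \<psi>)
  have "\<psi> ! i = \<phi> ! j" "\<psi> ! j = \<phi> ! i"
    using ij by (auto simp: \<psi>)
  moreover have "x ! i \<le> x ! j"
    using assms ij by (intro sorted_nth_mono) auto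
  moreover have "0 < \<phi> ! j" "\<phi> ! i < 1"
    using \<phi> ij by auto
  ultimately show ?thesis
    unfolding split rest using ij
    by (auto intro!: pgf_dvd_mult_left nb_fps_swap_pgf_dvd)
qed

text \<open>Swaps preserve the length and the set of entries, so the bounds on the first vector
  persist along the chain and the divisibilities compose.\<close>

lemma inversion_swaps_pgf_dvd:
  assumes "\<phi>s \<noteq> []" "\<forall>s. Suc s < length \<phi>s \<longrightarrow> inversion_swap (\<phi>s ! s) (\<phi>s ! Suc s)"
    and "sorted x" "length x = length (hd \<phi>s)" "\<forall>p\<in>set (hd \<phi>s). 0 < p \<and> p < 1"
  shows "pgf_dvd (nb_sum_fps x (last \<phi>s)) (nb_sum_fps x (hd \<phi>s))"
  using assms
\<comment> \<open>This induction exposes the first swap; a one-element chain is the reflexive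
  case.\<close>
proof (induction \<phi>s rule: induct_list012)
  case (3 \<phi> \<psi> \<phi>s)
  have swap: "inversion_swap \<phi> \<psi>"
    using 3(4)[rule_format, of 0] by simp
  have "pgf_dvd (nb_sum_fps x (last (\<psi> # \<phi>s))) (nb_sum_fps x (hd (\<psi> # \<phi>s)))"
  proof (rule 3(2))
    show "\<forall>s. Suc s < length (\<psi> # \<phi>s) \<longrightarrow>
        inversion_swap ((\<psi> # \<phi>s) ! s) ((\<psi> # \<phi>s) ! Suc s)"
      using 3(4) by (metis Suc_less_eq length_Cons nth_Cons_Suc)
  qed (use 3 inversion_swap_set_length[OF swap] in auto)
  moreover have "pgf_dvd (nb_sum_fps x \<psi>) (nb_sum_fps x \<phi>)"
    using 3(5-7) by (intro inversion_swap_pgf_dvd[OF swap]) simp_all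
  ultimately show ?case
    by (auto intro: pgf_dvd_trans)
qed (auto intro: pgf_dvd_refl)

lemma arr_le_pgf_dvd:
  assumes "arr_le (x1, y1) (x2, y2)" "\<forall>p\<in>set y1. 0 < p \<and> p < 1"
  shows "pgf_dvd (nb_sum_fps x2 y2) (nb_sum_fps x1 y1)"
proof -
  from assms(1) obtain \<phi>s where \<phi>s: "\<phi>s \<noteq> []"
      "\<forall>s. Suc s < length \<phi>s \<longrightarrow> inversion_swap (\<phi>s ! s) (\<phi>s ! Suc s)"
    and eq: "arr_eq (x1, y1) (sort x1, hd \<phi>s)" "arr_eq (sort x1, last \<phi>s) (x2, y2)"
    by (auto simp: arr_le_def)
  have "pgf_dvd (nb_sum_fps (sort x1) (last \<phi>s)) (nb_sum_fps (sort x1) (hd \<phi>s))"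
    using arr_eq_set_length[OF eq(1)] assms(2) by (intro inversion_swaps_pgf_dvd \<phi>s) auto
  then show ?thesis
    using arr_eq_nb_sum_fps[OF eq(1)] arr_eq_nb_sum_fps[OF eq(2)] by simp
qed

section \<open>Random variables with a given generating function\<close>

text \<open>Only point masses at naturals are prescribed; on a probability space they fix the law,
  since the coefficients already sum to 1.\<close>

definition has_pgf :: "'a measure \<Rightarrow> ('a \<Rightarrow> real) \<Rightarrow> real fps \<Rightarrow> bool" where
  "has_pgf M X f \<longleftrightarrow> is_pgf f \<and> X \<in> borel_measurable M \<and>
     (\<forall>k::nat. measure M {\<omega> \<in> space M. X \<omega> = real k} = fps_nth f k)"

lemma has_pgfD:
  assumes "has_pgf M X f"
  shows "is_pgf f" "X \<in> borel_measurable M"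
    "measure M {\<omega> \<in> space M. X \<omega> = real k} = fps_nth f k"
  using assms by (auto simp: has_pgf_def)

lemma neg_binomial_rv_has_pgf:
  assumes "neg_binomial_rv M X \<alpha> p" "0 \<le> \<alpha>" "0 < p" "p < 1"
  shows "has_pgf M X (nb_fps \<alpha> p)"
  using assms is_pgf_nb_fps[of \<alpha> p]
  by (auto simp: has_pgf_def neg_binomial_rv_def nb_fps_def)

lemma has_pgf_distr:
  assumes [measurable]: "X \<in> borel_measurable M" "\<phi> \<in> borel_measurable borel"
  shows "has_pgf (distr M borel X) \<phi> f \<longleftrightarrow> has_pgf M (\<lambda>\<omega>. \<phi> (X \<omega>)) f"
proof -
  have "measure (distr M borel X) {x \<in> space (distr M borel X). \<phi> x = real k} =
      measure M {\<omega> \<in> space M. \<phi> (X \<omega>) = real k}" for k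
    by (subst measure_distr) (auto intro!: arg_cong[where f = "measure M"])
  then show ?thesis by (simp add: has_pgf_def)
qed

context prob_space
begin

lemma has_pgf_AE_Nats:
  assumes "has_pgf M X f"
  shows "AE \<omega> in M. X \<omega> \<in> \<nat>"
proof -
  note [measurable] = has_pgfD(2)[OF assms]
  have "(\<lambda>k. prob {\<omega> \<in> space M. X \<omega> = real k}) sums prob {\<omega> \<in> space M. X \<omega> \<in> \<nat>}"
  proof (rule prob_sums)
    have "{\<omega> \<in> space M. X \<omega> \<in> \<nat>} = (\<Union>k::nat. {\<omega> \<in> space M. X \<omega> = real k})"
      by (auto elim!: Nats_cases)
    then show "{\<omega> \<in> space M. X \<omega> \<in> \<nat>} \<in> events"
      by simp
  qed (auto elim!: Nats_cases)
  moreover have "(\<lambda>k. prob {\<omega> \<in> space M. X \<omega> = real k}) sums 1"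
    using is_pgf_sums[OF has_pgfD(1)[OF assms]] has_pgfD(3)[OF assms] by simp
  ultimately have "prob {\<omega> \<in> space M. X \<omega> \<in> \<nat>} = 1"
    by (rule sums_unique2)
  from AE_prob_1[OF this] show ?thesis by auto
qed

text \<open>Up to a null set, the event that \<open>X\<close> lies in \<open>A\<close> is the
  disjoint union of the point events in \<open>A\<close>; hence the coefficients determine the
  law.\<close>

lemma has_pgf_sums:
  assumes f: "has_pgf M X f" and A: "A \<in> sets borel"
  shows "(\<lambda>k. if real k \<in> A then fps_nth f k else 0) sums prob (X -` A \<inter> space M)"
proof -
  note [measurable] = has_pgfD(2)[OF f] A
  have "(\<lambda>k. prob {\<omega> \<in> space M. X \<omega> = real k \<and> real k \<in> A}) sums prob {\<omega> \<in> space M. X \<omega> \<in> A}"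
  proof (rule prob_sums)
    show "AE \<omega> in M. (\<forall>k. X \<omega> = real k \<and> real k \<in> A \<longrightarrow> X \<omega> \<in> A) \<and>
        (X \<omega> \<in> A \<longrightarrow> (\<exists>!k. X \<omega> = real k \<and> real k \<in> A))"
      using has_pgf_AE_Nats[OF f] by eventually_elim (auto elim!: Nats_cases)
  qed auto
  moreover have "prob {\<omega> \<in> space M. X \<omega> = real k \<and> real k \<in> A} =
      (if real k \<in> A then fps_nth f k else 0)" for k
    using has_pgfD(3)[OF f, of k] by auto
  moreover have "{\<omega> \<in> space M. X \<omega> \<in> A} = X -` A \<inter> space M"
    by auto
  ultimately show ?thesis by simp
qed

text \<open>Where both values are natural, which is almost surely, \<open>X + Y = k\<close> splits
  into the disjoint cases \<open>X = i\<close>, \<open>Y = k - i\<close>; independence turns their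
  probabilities into the convolution.\<close>

lemma has_pgf_add:
  assumes f: "has_pgf M X f" and g: "has_pgf M Y g" and indep: "indep_var borel X borel Y"
  shows "has_pgf M (\<lambda>\<omega>. X \<omega> + Y \<omega>) (f * g)"
proof -
  note [measurable] = has_pgfD(2)[OF f] has_pgfD(2)[OF g]
  have "prob {\<omega> \<in> space M. X \<omega> + Y \<omega> = real k} = fps_nth (f * g) k" for k
  proof -
    have joint: "prob {\<omega> \<in> space M. X \<omega> = real i \<and> Y \<omega> = real j} = fps_nth f i * fps_nth g j" for i j
    proof -
      have "prob {\<omega> \<in> space M. X \<omega> = real i \<and> Y \<omega> = real j} =
          prob ((\<lambda>\<omega>. (X \<omega>, Y \<omega>)) -` ({real i} \<times> {real j}) \<inter> space M)"
        by (rule arg_cong[where f = prob]) auto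
      also have "\<dots> = prob (X -` {real i} \<inter> space M) * prob (Y -` {real j} \<inter> space M)"
        by (rule indep_varD[OF indep]) auto
      also have "X -` {real i} \<inter> space M = {\<omega> \<in> space M. X \<omega> = real i}"
        by auto
      also have "Y -` {real j} \<inter> space M = {\<omega> \<in> space M. Y \<omega> = real j}"
        by auto
      finally show ?thesis
        using has_pgfD(3)[OF f] has_pgfD(3)[OF g] by simp
    qed
    have "prob {\<omega> \<in> space M. X \<omega> + Y \<omega> = real k} =
        (\<Sum>i\<in>{0..k}. prob {\<omega> \<in> space M. X \<omega> = real i \<and> Y \<omega> = real (k - i)})"
    proof (rule prob_sum)
      show "AE \<omega> in M. (\<forall>i\<in>{0..k}. X \<omega> = real i \<and> Y \<omega> = real (k - i) \<longrightarrow> X \<omega> + Y \<omega> = real k) \<and>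
          (X \<omega> + Y \<omega> = real k \<longrightarrow> (\<exists>!i. i \<in> {0..k} \<and> X \<omega> = real i \<and> Y \<omega> = real (k - i)))"
        using has_pgf_AE_Nats[OF f] has_pgf_AE_Nats[OF g]
      proof eventually_elim
        case (elim \<omega>)
        then obtain a b where "X \<omega> = real a" "Y \<omega> = real b"
          by (auto elim!: Nats_cases)
        then show ?case
          by (auto simp flip: of_nat_add intro!: ex1I[of _ a])
      qed
    qed auto
    also have "\<dots> = fps_nth (f * g) k"
      unfolding fps_mult_nth joint ..
    finally show ?thesis .
  qed
  then show ?thesis
    using has_pgfD(1)[OF f] has_pgfD(1)[OF g] by (auto simp: has_pgf_def intro: is_pgf_mult)
qed

lemma has_pgf_sum:
  assumes "finite I" "indep_vars (\<lambda>_. borel) X I" "\<And>i. i \<in> I \<Longrightarrow> has_pgf M (X i) (f i)"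
  shows "has_pgf M (\<lambda>\<omega>. \<Sum>i\<in>I. X i \<omega>) (\<Prod>i\<in>I. f i)"
  using assms
proof (induction I rule: finite_induct)
  case empty
  show ?case
    by (auto simp: has_pgf_def is_pgf_1 prob_space)
next
  case (insert i I)
  have "has_pgf M (\<lambda>\<omega>. \<Sum>i\<in>I. X i \<omega>) (\<Prod>i\<in>I. f i)"
    using insert.prems by (intro insert.IH) (auto intro: indep_vars_subset)
  then show ?case
    using has_pgf_add[OF _ _ indep_vars_sum[OF insert.hyps insert.prems(1)]] insert by simp
qed

end

section \<open>Uniqueness, realisation and the convolution order\<close>

lemma has_pgf_distr_unique:
  assumes "prob_space M" "prob_space N" "has_pgf M X f" "has_pgf N Y f"
  shows "distr M borel X = distr N borel Y"
proof (rule measure_eqI)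
  interpret M: prob_space M by fact
  interpret N: prob_space N by fact
  fix A assume "A \<in> sets (distr M borel X)"
  then have A: "A \<in> sets borel" by simp
  have "measure M (X -` A \<inter> space M) = measure N (Y -` A \<inter> space N)"
    using M.has_pgf_sums[OF assms(3) A] N.has_pgf_sums[OF assms(4) A] by (rule sums_unique2)
  then show "emeasure (distr M borel X) A = emeasure (distr N borel Y) A"
    using A has_pgfD(2)[OF assms(3)] has_pgfD(2)[OF assms(4)]
    by (simp add: emeasure_distr M.emeasure_eq_measure N.emeasure_eq_measure)
qed simp

text \<open>The absolute value changes nothing on the naturals, and it makes the variable
  nonnegative at every real: \<open>conv_le\<close> demands \<open>0 \<le> Z\<close> everywhere, not
  just almost surely.\<close>

lemma is_pgf_realizable:
  assumes "is_pgf f"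
  obtains Q :: "nat pmf" where "has_pgf (distr (measure_pmf Q) borel real) (\<lambda>x. \<bar>x\<bar>) f"
proof -
  have sum1: "(\<integral>\<^sup>+k. ennreal (fps_nth f k) \<partial>count_space UNIV) = 1"
    using suminf_ennreal_eq[OF is_pgf_nonneg[OF assms] is_pgf_sums[OF assms]]
    by (simp add: nn_integral_count_space_nat)
  define Q where "Q = embed_pmf (fps_nth f)"
  have Q: "pmf Q k = fps_nth f k" for k
    unfolding Q_def by (rule pmf_embed_pmf[OF is_pgf_nonneg[OF assms] sum1])
  have "measure (distr (measure_pmf Q) borel real) {x \<in> UNIV. \<bar>x\<bar> = real k} = fps_nth f k" for k
  proof -
    have "real -` {x. \<bar>x\<bar> = real k} = {k}"
      by auto
    then show ?thesis
      by (subst measure_distr) (auto simp: measure_pmf_single Q)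
  qed
  then show thesis
    using assms by (intro that[of Q]) (auto simp: has_pgf_def)
qed

text \<open>The witness space is the product of the law of \<open>X\<close> with a law realising the
  cofactor: its coordinates are independent, and its points are pairs of reals as
  \<open>conv_le\<close> prescribes.\<close>

lemma conv_le_if_pgf_dvd:
  assumes M: "prob_space M" and N: "prob_space N"
    and f: "has_pgf M X f" and g: "has_pgf N Y g" and "pgf_dvd f g"
  shows "conv_le M X N Y"
proof -
  from \<open>pgf_dvd f g\<close> obtain h where h: "is_pgf h" "g = h * f"
    by (auto simp: pgf_dvd_def)
  from is_pgf_realizable[OF h(1)]
  obtain Q :: "nat pmf" where Q: "has_pgf (distr (measure_pmf Q) borel real) (\<lambda>x. \<bar>x\<bar>) h" .
  define A where "A = distr M borel X"
  define B where "B = distr (measure_pmf Q) borel real"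
  note [measurable] = has_pgfD(2)[OF f]
  interpret A: prob_space A
    unfolding A_def by (rule prob_space.prob_space_distr[OF M]) simp
  interpret B: prob_space B
    unfolding B_def by (rule prob_space.prob_space_distr[OF prob_space_measure_pmf]) simp
  interpret AB: pair_prob_space A B ..
  have [measurable_cong, simp]: "sets A = sets borel" "sets B = sets borel"
    by (simp_all add: A_def B_def)
  have fst_law: "distr (A \<Otimes>\<^sub>M B) borel fst = A"
    using B.distr_pair_fst[of A] distr_cong[of "A \<Otimes>\<^sub>M B" "A \<Otimes>\<^sub>M B" A borel fst fst] by simp
  \<comment> \<open>Exchanging the factors reduces the second marginal to a first one.\<close>
  have snd_law: "distr (A \<Otimes>\<^sub>M B) borel snd = B"
  proof -
    have "distr (A \<Otimes>\<^sub>M B) borel snd =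
        distr (distr (B \<Otimes>\<^sub>M A) (A \<Otimes>\<^sub>M B) (\<lambda>(x, y). (y, x))) borel snd"
      by (subst AB.distr_pair_swap) simp
    also have "\<dots> = distr (B \<Otimes>\<^sub>M A) borel fst"
      by (subst distr_distr) (auto simp: o_def case_prod_beta)
    also have "\<dots> = B"
      using A.distr_pair_fst[of B] distr_cong[of "B \<Otimes>\<^sub>M A" "B \<Otimes>\<^sub>M A" B borel fst fst] by simp
    finally show ?thesis .
  qed
  \<comment> \<open>The joint law of the two coordinates is the product measure itself.\<close>
  have "AB.indep_var borel fst borel snd"
    unfolding AB.indep_var_distribution_eq fst_law snd_law
    by (auto simp: distr_id2 intro!: distr_id2[symmetric] sets_pair_measure_cong)
  then have indep: "AB.indep_var borel fst borel (\<lambda>\<omega>. \<bar>snd \<omega>\<bar>)"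
    using AB.indep_var_compose[of borel fst borel snd "\<lambda>x. x" borel abs borel] by (simp add: o_def)
  have fst_pgf: "has_pgf (A \<Otimes>\<^sub>M B) fst f"
  proof -
    have "has_pgf A (\<lambda>x. x) f"
      unfolding A_def by (subst has_pgf_distr) (use f in auto)
    then have "has_pgf (distr (A \<Otimes>\<^sub>M B) borel fst) (\<lambda>x. x) f"
      unfolding fst_law .
    then show ?thesis
      by (subst (asm) has_pgf_distr) auto
  qed
  have snd_pgf: "has_pgf (A \<Otimes>\<^sub>M B) (\<lambda>\<omega>. \<bar>snd \<omega>\<bar>) h"
  proof -
    have "has_pgf (distr (A \<Otimes>\<^sub>M B) borel snd) (\<lambda>x. \<bar>x\<bar>) h"
      using Q by (simp add: snd_law flip: B_def)
    then show ?thesis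
      by (subst (asm) has_pgf_distr) auto
  qed
  have "has_pgf (A \<Otimes>\<^sub>M B) (\<lambda>\<omega>. fst \<omega> + \<bar>snd \<omega>\<bar>) g"
    using AB.has_pgf_add[OF fst_pgf snd_pgf indep] h(2) by (simp add: mult.commute)
  \<comment> \<open>Both variables have generating function \<open>g\<close>, which determines the
    law.\<close>
  then have "distr (A \<Otimes>\<^sub>M B) borel (\<lambda>\<omega>. fst \<omega> + \<bar>snd \<omega>\<bar>) = distr N borel Y"
    using has_pgf_distr_unique[OF AB.prob_space_axioms N] g by simp
  then show ?thesis
    unfolding conv_le_def
    using indep fst_law AB.prob_space_axioms has_pgfD(2)[OF f] has_pgfD(2)[OF g]
    by (intro conjI exI[of _ "A \<Otimes>\<^sub>M B"] exI[of _ fst] exI[of _ "\<lambda>\<omega>. \<bar>snd \<omega>\<bar>"])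
       (auto simp: A_def)
qed

theorem theorem4p13:
  fixes n :: nat
    and \<alpha>1 \<alpha>2 p1 p2 :: "real list"
    and M1 :: "'a measure" and M2 :: "'b measure"
    and X1 :: "nat \<Rightarrow> 'a \<Rightarrow> real" and X2 :: "nat \<Rightarrow> 'b \<Rightarrow> real"
  assumes "n \<ge> 1"
    and "length \<alpha>1 = n" "length p1 = n" "length \<alpha>2 = n" "length p2 = n"
    and "\<forall>i<n. \<alpha>1 ! i > 0" "\<forall>i<n. \<alpha>2 ! i > 0"
    and "\<forall>i<n. 0 < p1 ! i \<and> p1 ! i < 1" "\<forall>i<n. 0 < p2 ! i \<and> p2 ! i < 1"
    and "prob_space M1" "prob_space M2"
    and "prob_space.indep_vars M1 (\<lambda>_. borel) X1 {..<n}"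
    and "prob_space.indep_vars M2 (\<lambda>_. borel) X2 {..<n}"
    and "\<forall>i<n. neg_binomial_rv M1 (X1 i) (\<alpha>1 ! i) (p1 ! i)"
    and "\<forall>i<n. neg_binomial_rv M2 (X2 i) (\<alpha>2 ! i) (p2 ! i)"
    and "arr_le (\<alpha>1, p1) (\<alpha>2, p2)"
  shows "conv_le M2 (\<lambda>\<omega>. \<Sum>i<n. X2 i \<omega>) M1 (\<lambda>\<omega>. \<Sum>i<n. X1 i \<omega>)"
proof -
  interpret M1: prob_space M1 by fact
  interpret M2: prob_space M2 by fact
  have "has_pgf M1 (\<lambda>\<omega>. \<Sum>i<n. X1 i \<omega>) (\<Prod>i<n. nb_fps (\<alpha>1 ! i) (p1 ! i))"
    using assms by (intro M1.has_pgf_sum) (auto intro!: neg_binomial_rv_has_pgf less_imp_le)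
  moreover have "has_pgf M2 (\<lambda>\<omega>. \<Sum>i<n. X2 i \<omega>) (\<Prod>i<n. nb_fps (\<alpha>2 ! i) (p2 ! i))"
    using assms by (intro M2.has_pgf_sum) (auto intro!: neg_binomial_rv_has_pgf less_imp_le)
  moreover have "\<forall>p\<in>set p1. 0 < p \<and> p < 1"
    using assms by (metis in_set_conv_nth)
  \<comment> \<open>The second pairing has fewer inversions, or equally many, so its product is the
    divisor and its sum the lower variable.\<close>
  then have "pgf_dvd (\<Prod>i<n. nb_fps (\<alpha>2 ! i) (p2 ! i)) (\<Prod>i<n. nb_fps (\<alpha>1 ! i) (p1 ! i))"
    using arr_le_pgf_dvd[OF \<open>arr_le (\<alpha>1, p1) (\<alpha>2, p2)\<close>] assms(2,4)
    by (simp add: nb_sum_fps_def)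
  ultimately show ?thesis
    using conv_le_if_pgf_dvd[OF \<open>prob_space M2\<close> \<open>prob_space M1\<close>] by blast
qed

end
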